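(* Let $0<q<1$ and let $a,b,c$ be non-zero complex numbers. The functions $$u_1(z)={}_2\varphi_1(a,b;c;q,z)\quad(c\ne q^{-n},\ n=0,1,2,\dots),$$ $$u_2(z)=z^{1-\log_q(c)}\,{}_2\varphi_1(qa/c,qb/c;q^2/c;q,z)\quad(c\neq q^{n+2},\ n=0,1,2,\dots),$$ and the functions $$u_3(z)=z^{-\log_q(a)}\,{}_2\varphi_1\!\left(a,qa/c;qa/b;q,\tfrac{qc}{abz}\right)\quad(a\ne bq^{-n-1},\ n=0,1,2,\dots),$$ $$u_4(z)=z^{-\log_q(b)}\,{}_2\varphi_1\!\left(b,qb/c;qb/a;q,\tfrac{qc}{abz}\right)\quad(b\ne aq^{-n-1},\ n=0,1,2,\dots),$$ are solutions of the basic hypergeometric $q$-difference equation $$(c-abz)\,u(qz)+\bigl(-(c+q)+(a+b)z\bigr)u(z)+(q-z)\,u(z/q)=0 .$$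
   Context: ${}_2\varphi_1(a,b;c;q,z)=\sum_{n=0}^\infty\frac{(a;q)_n(b;q)_n}{(q;q)_n(c;q)_n}z^n$, convergent for $|z|<1$, with $(x;q)_n=\prod_{k=0}^{n-1}(1-xq^k)$. $\log_q(x)=\log x/\log q$ for a fixed choice of logarithm, and $z^s$ is taken with the principal branch, so that $(qz)^s=q^sz^s$. The equation is understood for those $z\neq 0$ for which all three points $qz,z,z/q$ lie in the region where the defining series converges (i.e. $|z|<q$ for $u_1,u_2$ and $|z|>|c/(ab)|$ for $u_3,u_4$). *)

theory Defs
  imports "HOL-Analysis.Analysis"
begin

definition qpoch :: "complex \<Rightarrow> complex \<Rightarrow> nat \<Rightarrow> complex" where
  "qpoch x q n = (\<Prod>k<n. 1 - x * q ^ k)"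

definition phi21 :: "complex \<Rightarrow> complex \<Rightarrow> complex \<Rightarrow> complex \<Rightarrow> complex \<Rightarrow> complex" where
  "phi21 a b c q z =
     (\<Sum>n. qpoch a q n * qpoch b q n / (qpoch q q n * qpoch c q n) * z ^ n)"

text \<open>The choice of logarithm is a parameter \<open>lg\<close>: any function with \<open>exp (lg x) = x\<close> for
  \<open>x \<noteq> 0\<close>. The denominator is the real logarithm of \<open>q\<close>; this is what makes \<open>q\<close> raised to the
  power \<open>log_q x\<close> (principal branch) equal to \<open>x\<close>.\<close>

definition is_log_choice :: "(complex \<Rightarrow> complex) \<Rightarrow> bool" where
  "is_log_choice lg \<longleftrightarrow> (\<forall>x. x \<noteq> 0 \<longrightarrow> exp (lg x) = x)"

definition log_q :: "(complex \<Rightarrow> complex) \<Rightarrow> real \<Rightarrow> complex \<Rightarrow> complex" where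
  "log_q lg q x = lg x / of_real (ln q)"

text \<open>On complex numbers \<open>powr\<close> is the principal branch.\<close>

definition u1 :: "real \<Rightarrow> complex \<Rightarrow> complex \<Rightarrow> complex \<Rightarrow> complex \<Rightarrow> complex" where
  "u1 q a b c z = phi21 a b c (of_real q) z"

definition u2 ::
  "(complex \<Rightarrow> complex) \<Rightarrow> real \<Rightarrow> complex \<Rightarrow> complex \<Rightarrow> complex \<Rightarrow> complex \<Rightarrow> complex" where
  "u2 lg q a b c z = z powr (1 - log_q lg q c) *
     phi21 (of_real q * a / c) (of_real q * b / c) ((of_real q)\<^sup>2 / c) (of_real q) z"

definition u3 ::
  "(complex \<Rightarrow> complex) \<Rightarrow> real \<Rightarrow> complex \<Rightarrow> complex \<Rightarrow> complex \<Rightarrow> complex \<Rightarrow> complex" where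
  "u3 lg q a b c z = z powr (- log_q lg q a) *
     phi21 a (of_real q * a / c) (of_real q * a / b) (of_real q) (of_real q * c / (a * b * z))"

definition u4 ::
  "(complex \<Rightarrow> complex) \<Rightarrow> real \<Rightarrow> complex \<Rightarrow> complex \<Rightarrow> complex \<Rightarrow> complex \<Rightarrow> complex" where
  "u4 lg q a b c z = z powr (- log_q lg q b) *
     phi21 b (of_real q * b / c) (of_real q * b / a) (of_real q) (of_real q * c / (a * b * z))"

text \<open>\<open>u\<close>, given on the region \<open>D\<close>, solves the basic hypergeometric equation at every \<open>z \<noteq> 0\<close>
  for which the three points entering the equation lie in \<open>D\<close>.\<close>

definition solves_qhyp ::
  "real \<Rightarrow> complex \<Rightarrow> complex \<Rightarrow> complex \<Rightarrow> complex set \<Rightarrow> (complex \<Rightarrow> complex) \<Rightarrow> bool" where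
  "solves_qhyp q a b c D u \<longleftrightarrow>
     (\<forall>z. z \<noteq> 0 \<and> of_real q * z \<in> D \<and> z \<in> D \<and> z / of_real q \<in> D \<longrightarrow>
        (c - a * b * z) * u (of_real q * z)
        + (- (c + of_real q) + (a + b) * z) * u z
        + (of_real q - z) * u (z / of_real q) = 0)"

text \<open>Regions of convergence of the series in \<open>z\<close> and in \<open>q c / (a b z)\<close>; together with
  \<open>solves_qhyp\<close> they give the ranges \<open>0 < |z| < q\<close> and \<open>|z| > |c / (a b)|\<close> respectively.\<close>

definition region_zero :: "complex set" where
  "region_zero = {z. norm z < 1}"

definition region_infinity :: "real \<Rightarrow> complex \<Rightarrow> complex \<Rightarrow> complex \<Rightarrow> complex set" where
  "region_infinity q a b c = {z. z \<noteq> 0 \<and> norm (of_real q * c / (a * b * z)) < 1}"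

end

theory Submission imports Defs begin

text \<open>Write the equation as \<open>(c - a b z) T + (- (c + q) + (a + b) z) + (q - z) T\<^sup>-\<^sup>1\<close> applied to
  \<open>u\<close>, where \<open>T\<close> is the shift \<open>u z \<mapsto> u (q z)\<close>. The part without the factor \<open>z\<close> is
  \<open>q T\<^sup>-\<^sup>1 (1 - T) (1 - (c / q) T)\<close> and the part with it is \<open>- z T\<^sup>-\<^sup>1 (1 - a T) (1 - b T)\<close>. On a power
  series \<open>T\<close> multiplies the coefficient of \<open>z ^ n\<close> by \<open>q ^ n\<close>, so the first part acts
  diagonally, the second does so up to the factor \<open>z\<close>, and the equation becomes the two-term recurrence
  \<open>(1 - q ^ (n + 1)) (1 - c q ^ n) t (n + 1) = (1 - a q ^ n) (1 - b q ^ n) t n\<close>, which is how the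
  coefficients of \<open>\<^sub>2\<phi>\<^sub>1\<close> are built (lemma \<open>phi21_qdifference\<close>).

  The other three solutions come from symmetries of the equation. Multiplying \<open>u\<close> by \<open>z powr s\<close>
  replaces \<open>T\<close> by \<open>q\<^sup>s T\<close> (lemma \<open>solves_qhyp_powr_mult\<close>). With \<open>q\<^sup>s = q / c\<close> the factors
  \<open>1 - T\<close> and \<open>1 - (c / q) T\<close> become \<open>1 - (q / c) T\<close> and \<open>1 - T\<close>, which turns the
  equation into the one with parameters \<open>(q a / c, q b / c, q\<^sup>2 / c)\<close>, which gives \<open>u2\<close>. The substitution
  \<open>w = q c / (a b z)\<close> exchanges \<open>T\<close> and \<open>T\<^sup>-\<^sup>1\<close> and hence the roles of zero and
  infinity; combined with \<open>q\<^sup>s = 1 / a\<close> it yields the equation with parameters \<open>(a, q a / c, q a / b)\<close> in \<open>w\<close>, which gives \<open>u3\<close>. Finally \<open>u4\<close> is \<open>u3\<close>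
  with \<open>a\<close> and \<open>b\<close> exchanged, under which the equation is invariant.\<close>

definition phi21_coeff :: "complex \<Rightarrow> complex \<Rightarrow> complex \<Rightarrow> complex \<Rightarrow> nat \<Rightarrow> complex" where
  "phi21_coeff a b c q n = qpoch a q n * qpoch b q n / (qpoch q q n * qpoch c q n)"

lemma one_minus_power_Suc_nonzero:
  fixes q :: complex
  assumes "norm q < 1"
  shows "1 - q ^ Suc n \<noteq> 0"
proof -
  have "norm (q ^ Suc n) < 1"
    using assms by (simp add: norm_power power_less_one_iff del: power_Suc)
  then show ?thesis by auto
qed

lemma phi21_coeff_Suc:
  "phi21_coeff a b c q (Suc n) =
    (1 - a * q ^ n) * (1 - b * q ^ n) / ((1 - q ^ Suc n) * (1 - c * q ^ n)) * phi21_coeff a b c q n"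
  by (simp add: phi21_coeff_def qpoch_def field_simps)

text \<open>The ratio of consecutive coefficients tends to \<open>1\<close>. The terms may vanish from some index on
  (for \<open>a = q ^ (- k)\<close>, say), so the ratio test is used in its multiplicative form.\<close>

lemma summable_phi21:
  assumes q: "norm q < 1" and z: "norm z < 1"
  shows "summable (\<lambda>n. phi21_coeff a b c q n * z ^ n)"
proof -
  define \<rho> where "\<rho> n = (1 - a * q ^ n) * (1 - b * q ^ n) /
    ((1 - q ^ Suc n) * (1 - c * q ^ n)) * z" for n
  have q0: "(\<lambda>n. q ^ n) \<longlonglongrightarrow> 0" using q by (rule LIMSEQ_power_zero)
  have "\<rho> \<longlonglongrightarrow> (1 - a * 0) * (1 - b * 0) / ((1 - q * 0) * (1 - c * 0)) * z"
    unfolding \<rho>_def power_Suc by (intro tendsto_intros q0) simp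
  then have "(\<lambda>n. norm (\<rho> n)) \<longlonglongrightarrow> norm z"
    by (auto dest: tendsto_norm)
  moreover have "norm z < (1 + norm z) / 2" using z by simp
  ultimately have "eventually (\<lambda>n. norm (\<rho> n) < (1 + norm z) / 2) sequentially"
    by (rule order_tendstoD)
  then obtain N where N: "\<And>n. n \<ge> N \<Longrightarrow> norm (\<rho> n) < (1 + norm z) / 2"
    by (auto simp: eventually_sequentially)
  show ?thesis
  proof (rule summable_ratio_test)
    show "(1 + norm z) / 2 < 1" using z by simp
    fix n assume "n \<ge> N"
    have "phi21_coeff a b c q (Suc n) * z ^ Suc n = \<rho> n * (phi21_coeff a b c q n * z ^ n)"
      unfolding phi21_coeff_Suc \<rho>_def by (simp add: mult_ac)
    then show "norm (phi21_coeff a b c q (Suc n) * z ^ Suc n)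
        \<le> (1 + norm z) / 2 * norm (phi21_coeff a b c q n * z ^ n)"
      using N[OF \<open>n \<ge> N\<close>] by (simp only: norm_mult) (intro mult_right_mono, auto)
  qed
qed

lemma phi21_sums:
  assumes "norm q < 1" and "norm z < 1"
  shows "(\<lambda>n. phi21_coeff a b c q n * z ^ n) sums phi21 a b c q z"
  using summable_sums[OF summable_phi21[OF assms]] by (simp add: phi21_def phi21_coeff_def)

text \<open>With \<open>x = z / q\<close> the two parts of the operator send \<open>t n z ^ n\<close> to \<open>A n\<close> and \<open>- B n\<close>. The
  recurrence says \<open>A (n + 1) = B n\<close>, and \<open>A 0 = 0\<close> because \<open>T\<close> fixes constants, so the two series
  have the same sum.\<close>

lemma phi21_qdifference:
  assumes q: "norm q < 1" "q \<noteq> 0" and c: "\<And>n. c * q ^ n \<noteq> 1" and z: "norm (z / q) < 1"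
  shows "(c - a * b * z) * phi21 a b c q (q * z) + (- (c + q) + (a + b) * z) * phi21 a b c q z
    + (q - z) * phi21 a b c q (z / q) = 0"
proof -
  define x where "x = z / q"
  have zx: "z = q * x" using q by (simp add: x_def)
  have x1: "norm x < 1" using z by (simp add: x_def)
  have shrink: "norm (q * y) < 1" if "norm y < 1" for y
    using mult_strict_mono'[of "norm q" 1 "norm y" 1] q that by (simp add: norm_mult)
  have z1: "norm z < 1" unfolding zx by (rule shrink[OF x1])
  have qz1: "norm (q * z) < 1" by (rule shrink[OF z1])
  let ?t = "phi21_coeff a b c q" and ?P = "phi21 a b c q"
  define A where "A n = c * (?t n * (q * z) ^ n) - (c + q) * (?t n * z ^ n) + q * (?t n * x ^ n)" for n
  define B where "B n = z * (a * b * (?t n * (q * z) ^ n) - (a + b) * (?t n * z ^ n) + ?t n * x ^ n)" for n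
  note s = phi21_sums[OF q(1)]
  have A: "A sums (c * ?P (q * z) - (c + q) * ?P z + q * ?P x)"
    unfolding A_def by (intro sums_add sums_diff sums_mult s qz1 z1 x1)
  have B: "B sums (z * (a * b * ?P (q * z) - (a + b) * ?P z + ?P x))"
    unfolding B_def by (intro sums_add sums_diff sums_mult s qz1 z1 x1)
  have "A (Suc n) = B n" for n
  proof -
    have "1 - q ^ Suc n \<noteq> 0" "1 - c * q ^ n \<noteq> 0"
      using one_minus_power_Suc_nonzero[OF q(1)] c[of n] by auto
    then have rec: "(1 - q ^ Suc n) * (1 - c * q ^ n) * ?t (Suc n) =
        (1 - a * q ^ n) * (1 - b * q ^ n) * ?t n"
      unfolding phi21_coeff_Suc by simp
    have "A (Suc n) = q * x ^ Suc n * ((1 - q ^ Suc n) * (1 - c * q ^ n) * ?t (Suc n))"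
      by (simp add: A_def zx power_mult_distrib algebra_simps)
    also have "\<dots> = B n"
      unfolding rec by (simp add: B_def zx power_mult_distrib algebra_simps)
    finally show ?thesis .
  qed
  moreover have "A 0 = 0" by (simp add: A_def algebra_simps)
  ultimately have "B sums (c * ?P (q * z) - (c + q) * ?P z + q * ?P x)"
    using A sums_Suc_iff[of A] by simp
  from sums_unique2[OF this B] show ?thesis
    unfolding x_def[symmetric] by (simp add: algebra_simps)
qed

lemma phi21_solves_qhyp:
  assumes "0 < q" "q < 1" and "\<And>n. c * of_real q ^ n \<noteq> 1"
  shows "solves_qhyp q a b c region_zero (phi21 a b c (of_real q))"
  using phi21_qdifference[of "of_real q" c _ a b] assms
  by (auto simp: solves_qhyp_def region_zero_def)

text \<open>Scaling by a positive real does not change the argument, so the principal branch is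
  multiplicative here.\<close>

lemma powr_scale:
  fixes z s :: complex
  assumes "0 < q" and "z \<noteq> 0"
  shows "(of_real q * z) powr s = exp (s * of_real (ln q)) * z powr s"
proof -
  have "Ln (of_real q * z) = of_real (ln q) + Ln z"
    using assms Ln_times_of_real[of q z] by (simp add: Ln_of_real)
  then show ?thesis using assms by (simp add: powr_def distrib_left exp_add)
qed

lemma exp_log_q:
  assumes "is_log_choice lg" and "0 < q" "q < 1" and "x \<noteq> 0"
  shows "exp (log_q lg q x * of_real (ln q)) = x"
proof -
  have "ln q \<noteq> 0" using assms by simp
  then show ?thesis using assms by (simp add: log_q_def is_log_choice_def)
qed

text \<open>A factor with multiplier \<open>k\<close> under \<open>z \<mapsto> q z\<close> conjugates the shift \<open>T\<close> into \<open>k T\<close>.\<close>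

lemma solves_qhyp_powr_mult:
  assumes q: "0 < q" and k: "exp (s * of_real (ln q)) = k"
    and v: "\<And>z. \<lbrakk>z \<noteq> 0; of_real q * z \<in> D; z \<in> D; z / of_real q \<in> D\<rbrakk> \<Longrightarrow>
      (c - a * b * z) * (k * v (of_real q * z)) + (- (c + of_real q) + (a + b) * z) * v z
      + (of_real q - z) * (v (z / of_real q) / k) = 0"
  shows "solves_qhyp q a b c D (\<lambda>z. z powr s * v z)"
  unfolding solves_qhyp_def
proof (intro allI impI, elim conjE)
  fix z assume z: "z \<noteq> 0" "of_real q * z \<in> D" "z \<in> D" "z / of_real q \<in> D"
  have k0: "k \<noteq> 0" using k by auto
  have up: "(of_real q * z) powr s = k * z powr s"
    using powr_scale[OF q z(1), of s] k by simp
  have "z powr s = k * (z / of_real q) powr s"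
    using powr_scale[OF q, of "z / of_real q" s] k q z(1) by simp
  then have down: "(z / of_real q) powr s = z powr s / k" using k0 by simp
  have "(c - a * b * z) * ((of_real q * z) powr s * v (of_real q * z))
      + (- (c + of_real q) + (a + b) * z) * (z powr s * v z)
      + (of_real q - z) * ((z / of_real q) powr s * v (z / of_real q))
    = z powr s * ((c - a * b * z) * (k * v (of_real q * z))
      + (- (c + of_real q) + (a + b) * z) * v z + (of_real q - z) * (v (z / of_real q) / k))"
    unfolding up down by (simp add: algebra_simps)
  then show "(c - a * b * z) * ((of_real q * z) powr s * v (of_real q * z))
      + (- (c + of_real q) + (a + b) * z) * (z powr s * v z)
      + (of_real q - z) * ((z / of_real q) powr s * v (z / of_real q)) = 0"
    using v[OF z] by simp
qed

lemma u2_solves_qhyp: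
  assumes q: "0 < q" "q < 1" and c: "c \<noteq> 0" and lg: "is_log_choice lg"
    and ne: "\<forall>n::nat. c \<noteq> of_real q ^ (n + 2)"
  shows "solves_qhyp q a b c region_zero (u2 lg q a b c)"
proof -
  let ?Q = "of_real q :: complex"
  let ?v = "phi21 (?Q * a / c) (?Q * b / c) (?Q\<^sup>2 / c) ?Q"
  have "exp ((1 - log_q lg q c) * of_real (ln q))
      = exp (of_real (ln q)) / exp (log_q lg q c * of_real (ln q))"
    by (simp add: left_diff_distrib exp_diff)
  then have k: "exp ((1 - log_q lg q c) * of_real (ln q)) = ?Q / c"
    unfolding exp_log_q[OF lg q c] using q by (simp add: exp_of_real)
  have ne': "?Q\<^sup>2 / c * ?Q ^ n \<noteq> 1" for n
    using ne[rule_format, of n] c by (auto simp: field_simps power2_eq_square)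
  have "(c - a * b * z) * (?Q / c * ?v (?Q * z)) + (- (c + ?Q) + (a + b) * z) * ?v z
      + (?Q - z) * (?v (z / ?Q) / (?Q / c)) = 0"
    if "z / ?Q \<in> region_zero" for z
  proof -
    have "norm (z / ?Q) < 1" using that by (simp add: region_zero_def)
    from phi21_qdifference[OF _ _ ne' this, of "?Q * a / c" "?Q * b / c"]
    have E: "(?Q\<^sup>2 / c - ?Q * a / c * (?Q * b / c) * z) * ?v (?Q * z)
        + (- (?Q\<^sup>2 / c + ?Q) + (?Q * a / c + ?Q * b / c) * z) * ?v z
        + (?Q - z) * ?v (z / ?Q) = 0"
      using q by simp
    have factor: "(c - a * b * z) * (?Q / c * V) + (- (c + ?Q) + (a + b) * z) * W + (?Q - z) * (X / (?Q / c))
      = c / ?Q * ((?Q\<^sup>2 / c - ?Q * a / c * (?Q * b / c) * z) * V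
        + (- (?Q\<^sup>2 / c + ?Q) + (?Q * a / c + ?Q * b / c) * z) * W + (?Q - z) * X)" for V W X
      using q c by (simp add: field_simps power2_eq_square)
    show ?thesis unfolding factor E by simp
  qed
  from solves_qhyp_powr_mult[OF q(1) k this]
  show ?thesis by (simp add: u2_def[abs_def])
qed

text \<open>In the variable \<open>w = q c / (a b z)\<close> one has \<open>z \<mapsto> q z\<close> exactly when \<open>w \<mapsto> w / q\<close>, and
  \<open>c - a b z = (c / w) (w - q)\<close>: after the factor \<open>z powr s\<close> with \<open>q\<^sup>s = 1 / a\<close> is removed and the
  equation is multiplied by \<open>- w a / c\<close>, the coefficient at \<open>q z\<close> is \<open>q - w\<close>, the one that belongs
  to \<open>w / q\<close>.\<close>

lemma u3_solves_qhyp: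
  assumes q: "0 < q" "q < 1" and nz: "a \<noteq> 0" "b \<noteq> 0" "c \<noteq> 0" and lg: "is_log_choice lg"
    and ne: "\<forall>n::nat. a \<noteq> b * of_real q powi (- int n - 1)"
  shows "solves_qhyp q a b c (region_infinity q a b c) (u3 lg q a b c)"
proof -
  let ?Q = "of_real q :: complex"
  let ?p = "phi21 a (?Q * a / c) (?Q * a / b) ?Q"
  let ?v = "\<lambda>z. ?p (?Q * c / (a * b * z))"
  have Q0: "?Q \<noteq> 0" using q by simp
  have k: "exp (- log_q lg q a * of_real (ln q)) = 1 / a"
    using exp_log_q[OF lg q nz(1)] by (simp add: exp_minus inverse_eq_divide)
  have ne': "?Q * a / b * ?Q ^ n \<noteq> 1" for n
  proof
    assume "?Q * a / b * ?Q ^ n = 1"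
    then have "a * ?Q ^ Suc n = b" using nz by (simp add: field_simps)
    then have "a = b * ?Q powi (- int (Suc n))"
      unfolding power_int_minus power_int_of_nat using Q0 by (auto simp: field_simps)
    moreover have "- int (Suc n) = - int n - 1" by simp
    ultimately show False using ne by metis
  qed
  have "(c - a * b * z) * (1 / a * ?v (?Q * z)) + (- (c + ?Q) + (a + b) * z) * ?v z
      + (?Q - z) * (?v (z / ?Q) / (1 / a)) = 0"
    if z: "z \<noteq> 0" and D: "?Q * z \<in> region_infinity q a b c" for z
  proof -
    define w where "w = ?Q * c / (a * b * z)"
    have w0: "w \<noteq> 0" using z nz Q0 by (simp add: w_def)
    have zw: "z = ?Q * c / (a * b * w)" using z nz Q0 by (simp add: w_def)
    have w_up: "?Q * c / (a * b * (?Q * z)) = w / ?Q" using Q0 by (simp add: w_def)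
    have w_down: "?Q * c / (a * b * (z / ?Q)) = ?Q * w" using Q0 by (simp add: w_def)
    have "norm (w / ?Q) < 1" using D unfolding region_infinity_def mem_Collect_eq w_up by blast
    from phi21_qdifference[OF _ _ ne' this, of a "?Q * a / c"]
    have E: "(?Q * a / b - a * (?Q * a / c) * w) * ?p (?Q * w)
        + (- (?Q * a / b + ?Q) + (a + ?Q * a / c) * w) * ?p w + (?Q - w) * ?p (w / ?Q) = 0"
      using q by simp
    have factor: "(c - a * b * z) * (1 / a * V) + (- (c + ?Q) + (a + b) * z) * W + (?Q - z) * (X / (1 / a))
      = - (c / (a * w)) * ((?Q * a / b - a * (?Q * a / c) * w) * X
        + (- (?Q * a / b + ?Q) + (a + ?Q * a / c) * w) * W + (?Q - w) * V)" for V W X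
      unfolding zw using nz w0 by (simp add: field_simps)
    show ?thesis unfolding w_up w_down w_def[symmetric] factor E by simp
  qed
  from solves_qhyp_powr_mult[OF q(1) k this]
  show ?thesis by (simp add: u3_def[abs_def])
qed

lemma u4_eq_u3_swap: "u4 lg q a b c = u3 lg q b a c"
  by (simp add: fun_eq_iff u3_def u4_def mult.commute)

lemma solves_qhyp_swap: "solves_qhyp q a b c D u \<longleftrightarrow> solves_qhyp q b a c D u"
  by (simp add: solves_qhyp_def mult.commute add.commute)

lemma region_infinity_swap: "region_infinity q a b c = region_infinity q b a c"
  by (simp add: region_infinity_def mult.commute)

theorem proposition3p1:
  fixes q :: real and a b c :: complex and lg :: "complex \<Rightarrow> complex"
  assumes "0 < q" and "q < 1"
    and "a \<noteq> 0" and "b \<noteq> 0" and "c \<noteq> 0"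
    and "is_log_choice lg"
  shows "((\<forall>n::nat. c \<noteq> of_real q powi (- int n)) \<longrightarrow>
            solves_qhyp q a b c region_zero (u1 q a b c)) \<and>
         ((\<forall>n::nat. c \<noteq> of_real q ^ (n + 2)) \<longrightarrow>
            solves_qhyp q a b c region_zero (u2 lg q a b c)) \<and>
         ((\<forall>n::nat. a \<noteq> b * of_real q powi (- int n - 1)) \<longrightarrow>
            solves_qhyp q a b c (region_infinity q a b c) (u3 lg q a b c)) \<and>
         ((\<forall>n::nat. b \<noteq> a * of_real q powi (- int n - 1)) \<longrightarrow>
            solves_qhyp q a b c (region_infinity q a b c) (u4 lg q a b c))"
proof (intro conjI impI)
  assume c: "\<forall>n::nat. c \<noteq> of_real q powi (- int n)"
  have "c * of_real q ^ n \<noteq> 1" for n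
  proof
    assume "c * of_real q ^ n = 1"
    then have "c = of_real q powi (- int n)"
      using \<open>0 < q\<close> by (simp add: power_int_minus field_simps)
    then show False using c by blast
  qed
  from phi21_solves_qhyp[OF assms(1,2) this]
  show "solves_qhyp q a b c region_zero (u1 q a b c)" by (simp add: u1_def[abs_def])
next
  assume "\<forall>n::nat. c \<noteq> of_real q ^ (n + 2)"
  then show "solves_qhyp q a b c region_zero (u2 lg q a b c)"
    using assms by (intro u2_solves_qhyp)
next
  assume "\<forall>n::nat. a \<noteq> b * of_real q powi (- int n - 1)"
  then show "solves_qhyp q a b c (region_infinity q a b c) (u3 lg q a b c)"
    using assms by (intro u3_solves_qhyp)
next
  assume "\<forall>n::nat. b \<noteq> a * of_real q powi (- int n - 1)"
  then have "solves_qhyp q b a c (region_infinity q b a c) (u3 lg q b a c)"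
    using assms by (intro u3_solves_qhyp)
  then show "solves_qhyp q a b c (region_infinity q a b c) (u4 lg q a b c)"
    by (simp only: u4_eq_u3_swap solves_qhyp_swap[of q a] region_infinity_swap[of q a])
qed

end
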